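(* Let $G$ be a graph. Then $\operatorname{pf}(G) \geq \operatorname{spf}(G) + 1$.
   Context: Graphs are finite and simple. Given an orientation $D$ of a graph $G$ with vertices enumerated $1,\dots,2m$ and a perfect matching $M$ of $G$, $\operatorname{sign}_D(M)\in\{1,-1\}$ is the sign of the permutation $\begin{pmatrix}1&2&\cdots&2m-1&2m\\ u_1&v_1&\cdots&u_m&v_m\end{pmatrix}$, where the edges of $M$ are $u_iv_i$, oriented in $D$ from $u_i$ to $v_i$ (independent of the order in which the edges are listed). Let $\mathcal{M}(G)$ be the set of perfect matchings of $G$. Pfaffian number: for a positive integer $k$, a $k$-orientation of $G$ is a vector $\mathbf{D}=(D_1,\dots,D_k)$ of orientations of $G$; for $M\in\mathcal{M}(G)$, $\mathbf{sign}_{\mathbf{D}}(M) := (\operatorname{sign}_{D_1}(M),\dots,\operatorname{sign}_{D_k}(M))$, and the signature matrix $\mathbf{sign}_{\mathbf{D}}$ has these vectors as rows, one row for each $M\in\mathcal{M}(G)$. $\mathbf{D}$ is pfaffian if $\mathbf{sign}_{\mathbf{D}}\,\mathbf{x}=\mathbf{1}$ has a solution $\mathbf{x}\in\mathbb{R}^k$. $G$ is $k$-pfaffian if it admits a pfaffian $k$-orientation (independent of the enumeration of the vertices). The pfaffian number $\operatorname{pf}(G)$ is the smallest positive integer $k$ such that $G$ is $k$-pfaffian (it always exists). Symbolic pfaffian number: for an integer $d\ge 0$, a $d$-symbolic function of $G$ is a function $\tau\colon E(G)\to \mathrm{GF}(2)^d$, extended to perfect matchings by $\tau(M)=\bigoplus_{e\in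 M}\tau(e)$ (sum in $\mathrm{GF}(2)^d$). A $d$-symbolic orientation of $G$ is a pair $(D,\tau)$ where $D$ is an orientation of $G$ and $\tau$ a $d$-symbolic function of $G$. It is pfaffian if for every pair of perfect matchings $M,N$ of $G$, $\operatorname{sign}_D(M)\ne\operatorname{sign}_D(N)$ implies $\tau(M)\neq\tau(N)$. The symbolic pfaffian number $\operatorname{spf}(G)$ is the smallest integer $d\ge 0$ such that $G$ admits a pfaffian $d$-symbolic orientation (it always exists). *)

theory Defs
  imports
    Complex_Main
    "HOL-Combinatorics.Permutations"
    "HOL-Library.Z2"
    "Jordan_Normal_Form.Matrix"
begin

definition simple_graph :: "'a set \<Rightarrow> 'a set set \<Rightarrow> bool" where
  "simple_graph V E \<longleftrightarrow> finite V \<and> (\<forall>e\<in>E. e \<subseteq> V \<and> card e = 2)"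

definition perfect_matchings :: "'a set \<Rightarrow> 'a set set \<Rightarrow> 'a set set set" where
  "perfect_matchings V E = {M. M \<subseteq> E \<and> (\<forall>v\<in>V. \<exists>!e. e \<in> M \<and> v \<in> e)}"

text \<open>The arc \<open>(u, v)\<close> stands for the edge \<open>{u, v}\<close> oriented from \<open>u\<close> to \<open>v\<close>.\<close>

definition orientation :: "'a set set \<Rightarrow> ('a \<times> 'a) set \<Rightarrow> bool" where
  "orientation E D \<longleftrightarrow>
     (\<forall>u v. (u, v) \<in> D \<longrightarrow> {u, v} \<in> E) \<and>
     (\<forall>u v. {u, v} \<in> E \<longrightarrow> ((u, v) \<in> D \<longleftrightarrow> (v, u) \<notin> D))"

definition enumeration :: "'a set \<Rightarrow> ('a \<Rightarrow> nat) \<Rightarrow> bool" where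
  "enumeration V \<nu> \<longleftrightarrow> bij_betw \<nu> V {1..card V}"


subsection \<open>The sign of a perfect matching\<close>

definition arc_listing :: "('a \<times> 'a) set \<Rightarrow> 'a set set \<Rightarrow> ('a \<times> 'a) list \<Rightarrow> bool" where
  "arc_listing D M as \<longleftrightarrow> distinct as \<and> set as = {(u, v) \<in> D. {u, v} \<in> M}"

text \<open>
  For \<open>as = [(u\<^sub>1, v\<^sub>1), \<dots>, (u\<^sub>m, v\<^sub>m)]\<close> this is the map given in two-line notation by the top row
  \<open>1, 2, \<dots>, 2m - 1, 2m\<close> and the bottom row \<open>\<nu> u\<^sub>1, \<nu> v\<^sub>1, \<dots>, \<nu> u\<^sub>m, \<nu> v\<^sub>m\<close>, extended by the
  identity outside \<open>{1..2m}\<close>.  Lists are indexed from 0, so position \<open>i\<close> belongs to the arc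
  \<open>as ! ((i - 1) div 2)\<close>.
\<close>

definition listing_perm :: "('a \<Rightarrow> nat) \<Rightarrow> ('a \<times> 'a) list \<Rightarrow> nat \<Rightarrow> nat" where
  "listing_perm \<nu> as i =
     (if i \<in> {1..2 * length as}
      then \<nu> ((if odd i then fst else snd) (as ! ((i - 1) div 2)))
      else i)"

text \<open>The choice of the listing is immaterial: see \<open>matching_sign_eq\<close> below.\<close>

definition matching_sign :: "('a \<Rightarrow> nat) \<Rightarrow> ('a \<times> 'a) set \<Rightarrow> 'a set set \<Rightarrow> int" where
  "matching_sign \<nu> D M = sign (listing_perm \<nu> (SOME as. arc_listing D M as))"


subsection \<open>The pfaffian number\<close>

text \<open>A \<open>k\<close>-orientation is a list of \<open>k\<close> orientations.\<close>

definition k_orientation :: "'a set set \<Rightarrow> nat \<Rightarrow> ('a \<times> 'a) set list \<Rightarrow> bool" where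
  "k_orientation E k Ds \<longleftrightarrow> length Ds = k \<and> (\<forall>D\<in>set Ds. orientation E D)"

definition sign_vector ::
    "('a \<Rightarrow> nat) \<Rightarrow> ('a \<times> 'a) set list \<Rightarrow> 'a set set \<Rightarrow> real vec" where
  "sign_vector \<nu> Ds M = vec (length Ds) (\<lambda>i. real_of_int (matching_sign \<nu> (Ds ! i) M))"

text \<open>
  The rows of the signature matrix are the vectors \<open>sign_vector \<nu> Ds M\<close>, indexed by the perfect
  matchings \<open>M\<close> themselves, so the linear system is written row by row.
\<close>

definition pfaffian_orientation ::
    "'a set \<Rightarrow> 'a set set \<Rightarrow> ('a \<Rightarrow> nat) \<Rightarrow> ('a \<times> 'a) set list \<Rightarrow> bool" where
  "pfaffian_orientation V E \<nu> Ds \<longleftrightarrow>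
     (\<exists>x\<in>carrier_vec (length Ds). \<forall>M\<in>perfect_matchings V E. sign_vector \<nu> Ds M \<bullet> x = 1)"

text \<open>The enumeration of the vertices is immaterial: see \<open>k_pfaffian_iff\<close> below.\<close>

definition k_pfaffian :: "'a set \<Rightarrow> 'a set set \<Rightarrow> nat \<Rightarrow> bool" where
  "k_pfaffian V E k \<longleftrightarrow>
     (\<exists>\<nu> Ds. enumeration V \<nu> \<and> k_orientation E k Ds \<and> pfaffian_orientation V E \<nu> Ds)"

definition pf :: "'a set \<Rightarrow> 'a set set \<Rightarrow> nat" where
  "pf V E = (LEAST k. 0 < k \<and> k_pfaffian V E k)"


subsection \<open>The symbolic pfaffian number\<close>

definition symbolic_function :: "'a set set \<Rightarrow> nat \<Rightarrow> ('a set \<Rightarrow> bit vec) \<Rightarrow> bool" where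
  "symbolic_function E d \<tau> \<longleftrightarrow> \<tau> \<in> E \<rightarrow> carrier_vec d"

definition symbolic_sum :: "nat \<Rightarrow> ('a set \<Rightarrow> bit vec) \<Rightarrow> 'a set set \<Rightarrow> bit vec" where
  "symbolic_sum d \<tau> M = finsum_vec TYPE(bit) d \<tau> M"

definition symbolic_orientation ::
    "'a set set \<Rightarrow> nat \<Rightarrow> ('a \<times> 'a) set \<Rightarrow> ('a set \<Rightarrow> bit vec) \<Rightarrow> bool" where
  "symbolic_orientation E d D \<tau> \<longleftrightarrow> orientation E D \<and> symbolic_function E d \<tau>"

definition pfaffian_symbolic ::
    "'a set \<Rightarrow> 'a set set \<Rightarrow> ('a \<Rightarrow> nat) \<Rightarrow> nat \<Rightarrow> ('a \<times> 'a) set \<Rightarrow> ('a set \<Rightarrow> bit vec) \<Rightarrow> bool" where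
  "pfaffian_symbolic V E \<nu> d D \<tau> \<longleftrightarrow>
     (\<forall>M\<in>perfect_matchings V E. \<forall>N\<in>perfect_matchings V E.
        matching_sign \<nu> D M \<noteq> matching_sign \<nu> D N \<longrightarrow> symbolic_sum d \<tau> M \<noteq> symbolic_sum d \<tau> N)"

text \<open>Again the enumeration is immaterial: see \<open>d_symbolic_pfaffian_iff\<close> below.\<close>

definition d_symbolic_pfaffian :: "'a set \<Rightarrow> 'a set set \<Rightarrow> nat \<Rightarrow> bool" where
  "d_symbolic_pfaffian V E d \<longleftrightarrow>
     (\<exists>\<nu> D \<tau>. enumeration V \<nu> \<and> symbolic_orientation E d D \<tau> \<and> pfaffian_symbolic V E \<nu> d D \<tau>)"

definition spf :: "'a set \<Rightarrow> 'a set set \<Rightarrow> nat" where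
  "spf V E = (LEAST d. d_symbolic_pfaffian V E d)"


subsection \<open>Independence of the listing of the edges\<close>

lemma ex_arc_listing:
  assumes "simple_graph V E" "orientation E D"
  shows "\<exists>as. arc_listing D M as"
proof -
  have "u \<in> V \<and> v \<in> V" if "(u, v) \<in> D" for u v
  proof -
    have "{u, v} \<in> E" using that assms(2) by (simp add: orientation_def)
    then show ?thesis using assms(1) by (auto simp: simple_graph_def)
  qed
  then have "D \<subseteq> V \<times> V" by auto
  moreover have "finite V" using assms(1) by (simp add: simple_graph_def)
  ultimately have "finite D" by (meson finite_SigmaI finite_subset)
  then have "finite {(u, v) \<in> D. {u, v} \<in> M}"
    by (rule rev_finite_subset) auto
  then show ?thesis
    unfolding arc_listing_def using finite_distinct_list by blast
qed

definition block_perm :: "(nat \<Rightarrow> nat) \<Rightarrow> nat \<Rightarrow> nat" where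
  "block_perm f i = (if i = 0 then 0 else 2 * f ((i - 1) div 2) + (i - 1) mod 2 + 1)"

lemma block_perm_comp: "block_perm (f \<circ> g) = block_perm f \<circ> block_perm g"
  by (rule ext) (auto simp: block_perm_def)

lemma block_perm_id: "block_perm id = id"
  by (rule ext) (auto simp: block_perm_def)

lemma block_perm_transpose:
  assumes "a \<noteq> b"
  shows "block_perm (transpose a b) =
    transpose (2 * a + 1) (2 * b + 1) \<circ> transpose (2 * a + 2) (2 * b + 2)"
proof
  fix i :: nat
  show "block_perm (transpose a b) i =
    (transpose (2 * a + 1) (2 * b + 1) \<circ> transpose (2 * a + 2) (2 * b + 2)) i"
  proof (cases i)
    case 0
    then show ?thesis by (simp add: block_perm_def transpose_def)
  next
    case (Suc j)
    define q where "q = j div 2"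
    have sw: "block_perm (transpose a b) i = 2 * transpose a b q + j mod 2 + 1"
      by (simp add: block_perm_def Suc q_def)
    have "j = 2 * q \<or> j = 2 * q + 1" unfolding q_def by linarith
    moreover have "Suc (2 * x) \<noteq> 2 * y" "2 * y \<noteq> Suc (2 * x)" for x y :: nat
      by presburger+
    ultimately show ?thesis
      unfolding sw by (auto simp: Suc transpose_def)
  qed
qed

lemma block_perm_sign:
  assumes "permutation f"
  shows "permutation (block_perm f) \<and> sign (block_perm f) = 1"
proof -
  obtain n where "swapidseq n f" using assms by (auto simp: permutation_def)
  then show ?thesis
  proof (induction rule: swapidseq.induct)
    case id
    show ?case unfolding block_perm_id by simp
  next
    case (comp_Suc n p a b)
    have "permutation (block_perm (transpose a b))"
      unfolding block_perm_transpose[OF comp_Suc.hyps(2)]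
      by (intro permutation_compose permutation_swap_id)
    moreover have "sign (block_perm (transpose a b)) = 1"
      unfolding block_perm_transpose[OF comp_Suc.hyps(2)] using comp_Suc.hyps(2)
      by (simp add: sign_compose permutation_swap_id sign_swap_id)
    ultimately show ?case
      using comp_Suc.IH unfolding block_perm_comp
      by (metis permutation_compose sign_compose mult_1)
  qed
qed

lemma listing_perm_permutes:
  assumes G: "simple_graph V E" and D: "orientation E D"
    and M: "M \<in> perfect_matchings V E" and \<nu>: "enumeration V \<nu>"
    and as: "arc_listing D M as"
  shows "listing_perm \<nu> as permutes {1..card V}" and "2 * length as = card V"
proof -
  define m where "m = length as"
  define w where "w i = (if odd i then fst else snd) (as ! ((i - 1) div 2))" for i :: nat
  have arcs: "set as = {(u, v) \<in> D. {u, v} \<in> M}" and dist: "distinct as"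
    using as by (auto simp: arc_listing_def)
  have ME: "M \<subseteq> E" and ex1: "\<And>v. v \<in> V \<Longrightarrow> \<exists>!e. e \<in> M \<and> v \<in> e"
    using M by (auto simp: perfect_matchings_def)
  have noloop: "u \<noteq> v" if "{u, v} \<in> E" for u v
    using that G by (force simp: simple_graph_def)
  have antisym: "(v, u) \<notin> D" if "(u, v) \<in> D" for u v
    using that D unfolding orientation_def by blast
  have inV: "u \<in> V" "v \<in> V" if "{u, v} \<in> M" for u v
    using that ME G unfolding simple_graph_def by blast+
  have uniq: "p = q" if p: "p \<in> set as" and q: "q \<in> set as"
    and z: "z \<in> {fst p, snd p}" "z \<in> {fst q, snd q}" for p q z
  proof -
    obtain a b c d where pq: "p = (a, b)" "q = (c, d)" by fastforce
    have mem: "{a, b} \<in> M" "{c, d} \<in> M" "(a, b) \<in> D" "(c, d) \<in> D"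
      using p q arcs pq by auto
    have "z \<in> V" using z(1) pq inV[OF mem(1)] by auto
    then have "{a, b} = {c, d}" using ex1[of z] mem z pq by auto
    then show ?thesis using mem antisym pq by (metis doubleton_eq_iff)
  qed
  have idx: "(i - 1) div 2 < m" if "i \<in> {1..2 * m}" for i
    using that by auto
  have inj: "inj_on w {1..2 * m}"
  proof (rule inj_onI)
    fix i j assume i: "i \<in> {1..2 * m}" and j: "j \<in> {1..2 * m}" and eq: "w i = w j"
    let ?p = "as ! ((i - 1) div 2)" and ?q = "as ! ((j - 1) div 2)"
    have mem: "?p \<in> set as" "?q \<in> set as" using idx[OF i] idx[OF j] by (auto simp: m_def)
    have "?p = ?q"
    proof (rule uniq[OF mem])
      show "w i \<in> {fst ?p, snd ?p}" by (simp add: w_def)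
      show "w i \<in> {fst ?q, snd ?q}" unfolding eq by (simp add: w_def)
    qed
    then have div_eq: "(i - 1) div 2 = (j - 1) div 2"
      using dist idx[OF i] idx[OF j] by (simp add: nth_eq_iff_index_eq m_def)
    have "fst ?p \<noteq> snd ?p"
      using mem(1) arcs ME noloop by auto
    then have "odd i \<longleftrightarrow> odd j"
      using eq \<open>?p = ?q\<close> by (auto simp: w_def split: if_splits)
    moreover have "i - 1 + 1 = i" "j - 1 + 1 = j" using i j by auto
    ultimately show "i = j" using div_eq by presburger
  qed
  have img: "w ` {1..2 * m} = V"
  proof
    show "w ` {1..2 * m} \<subseteq> V"
    proof
      fix x assume "x \<in> w ` {1..2 * m}"
      then obtain i where i: "i \<in> {1..2 * m}" "x = w i" by blast
      let ?p = "as ! ((i - 1) div 2)"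
      have "?p \<in> set as" using idx[OF i(1)] by (auto simp: m_def)
      then have "{fst ?p, snd ?p} \<in> M" using arcs by auto
      from inV[OF this] show "x \<in> V" by (auto simp: i(2) w_def)
    qed
    show "V \<subseteq> w ` {1..2 * m}"
    proof
      fix x assume "x \<in> V"
      then obtain e where e: "e \<in> M" "x \<in> e" using ex1 by blast
      have "card e = 2" using e ME G by (auto simp: simple_graph_def)
      then obtain y where y: "e = {x, y}"
        using e(2) by (auto simp: card_2_iff)
      then have "(x, y) \<in> D \<or> (y, x) \<in> D"
        using D e ME unfolding orientation_def by blast
      then have "(x, y) \<in> set as \<or> (y, x) \<in> set as"
        using arcs e y by (auto simp: insert_commute)
      then obtain k where k: "k < m" "as ! k = (x, y) \<or> as ! k = (y, x)"
        by (auto simp: in_set_conv_nth m_def)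
      from k(2) show "x \<in> w ` {1..2 * m}"
      proof
        assume "as ! k = (x, y)"
        then have "x = w (2 * k + 1)" by (simp add: w_def)
        then show ?thesis using k(1) by (intro image_eqI[of _ _ "2 * k + 1"]) auto
      next
        assume "as ! k = (y, x)"
        then have "x = w (2 * k + 2)" by (simp add: w_def)
        then show ?thesis using k(1) by (intro image_eqI[of _ _ "2 * k + 2"]) auto
      qed
    qed
  qed
  have bij: "bij_betw w {1..2 * m} V" using inj img by (simp add: bij_betw_def)
  then show card: "2 * length as = card V"
    using bij_betw_same_card[OF bij] by (simp add: m_def)
  have "bij_betw (\<nu> \<circ> w) {1..card V} {1..card V}"
    using bij_betw_trans[OF bij] \<nu> card by (auto simp: enumeration_def m_def)
  then have "bij_betw (listing_perm \<nu> as) {1..card V} {1..card V}"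
    by (rule bij_betw_cong[THEN iffD1, rotated])
       (simp add: listing_perm_def w_def card)
  then show "listing_perm \<nu> as permutes {1..card V}"
    by (rule bij_imp_permutes) (auto simp: listing_perm_def card)
qed

lemma matching_sign_eq:
  assumes G: "simple_graph V E" and D: "orientation E D"
    and M: "M \<in> perfect_matchings V E" and \<nu>: "enumeration V \<nu>"
    and as: "arc_listing D M as"
  shows "matching_sign \<nu> D M = sign (listing_perm \<nu> as)"
proof -
  define bs where "bs = (SOME as. arc_listing D M as)"
  have bs: "arc_listing D M bs"
    unfolding bs_def using as by (rule someI)
  have "mset bs = mset as"
    using as bs unfolding arc_listing_def by (metis set_eq_iff_mset_eq_distinct)
  then obtain f where f: "f permutes {..<length as}" "permute_list f as = bs"
    by (rule mset_eq_permutation)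
  have len: "length bs = length as" using f(2) by auto
  have nth: "bs ! k = as ! f k" if "k < length as" for k
    using that f permute_list_nth by blast
  have f_lt: "f k < length as" if "k < length as" for k
    using that permutes_in_image[OF f(1)] by simp
  have "listing_perm \<nu> bs = listing_perm \<nu> as \<circ> block_perm f"
  proof
    fix i
    show "listing_perm \<nu> bs i = (listing_perm \<nu> as \<circ> block_perm f) i"
    proof (cases "i \<in> {1..2 * length as}")
      case True
      then have lt: "(i - 1) div 2 < length as" by auto
      have par: "odd (block_perm f i) \<longleftrightarrow> odd i"
      proof -
        obtain k where "i = Suc k" using True by (cases i) auto
        then show ?thesis unfolding block_perm_def by simp
      qed
      have dv: "(block_perm f i - 1) div 2 = f ((i - 1) div 2)"
        using True by (simp add: block_perm_def)
      have "(i - 1) mod 2 < 2" by simp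
      then have "block_perm f i \<in> {1..2 * length as}"
        using True f_lt[OF lt] unfolding block_perm_def by auto
      then show ?thesis
        using True by (simp only: listing_perm_def len par dv nth[OF lt] o_def if_True)
    next
      case False
      have "block_perm f i = i"
      proof (cases "i = 0")
        case True
        then show ?thesis by (simp add: block_perm_def)
      next
        case nz: False
        then have "(i - 1) div 2 \<notin> {..<length as}" using False by auto
        then show ?thesis
          using nz permutes_not_in[OF f(1)] by (simp add: block_perm_def)
      qed
      then show ?thesis using False by (auto simp: listing_perm_def len)
    qed
  qed
  moreover have "permutation (listing_perm \<nu> as)"
    using listing_perm_permutes(1)[OF G D M \<nu> as] permutation_permutes by blast
  ultimately show ?thesis
    using block_perm_sign[of f] f(1) permutation_permutes[of f]
    unfolding matching_sign_def bs_def[symmetric]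
    by (metis finite_lessThan mult.right_neutral sign_compose)
qed


subsection \<open>Independence of the enumeration of the vertices\<close>

lemma ex_enumeration:
  assumes "finite V"
  shows "\<exists>\<nu>. enumeration V \<nu>"
  unfolding enumeration_def using assms by (simp add: bij_betw_iff_card)

lemma matching_sign_change_enumeration:
  assumes G: "simple_graph V E" and \<nu>: "enumeration V \<nu>" and \<nu>': "enumeration V \<nu>'"
  obtains c where "c \<in> {1, - 1}"
    and "\<And>D M. orientation E D \<Longrightarrow> M \<in> perfect_matchings V E \<Longrightarrow>
      matching_sign \<nu>' D M = c * matching_sign \<nu> D M"
proof -
  define \<sigma> where "\<sigma> i = (if i \<in> {1..card V} then \<nu>' (inv_into V \<nu> i) else i)" for i
  have b: "bij_betw \<nu> V {1..card V}" "bij_betw \<nu>' V {1..card V}"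
    using \<nu> \<nu>' by (auto simp: enumeration_def)
  have "bij_betw (\<nu>' \<circ> inv_into V \<nu>) {1..card V} {1..card V}"
    using bij_betw_trans[OF bij_betw_inv_into[OF b(1)] b(2)] .
  then have "bij_betw \<sigma> {1..card V} {1..card V}"
    by (rule bij_betw_cong[THEN iffD1, rotated]) (simp add: \<sigma>_def)
  then have \<sigma>: "\<sigma> permutes {1..card V}"
    by (rule bij_imp_permutes) (auto simp: \<sigma>_def)
  have \<sigma>_\<nu>: "\<sigma> (\<nu> v) = \<nu>' v" if "v \<in> V" for v
    using that b(1) by (simp add: \<sigma>_def bij_betw_def) auto
  have "matching_sign \<nu>' D M = sign \<sigma> * matching_sign \<nu> D M"
    if D: "orientation E D" and M: "M \<in> perfect_matchings V E" for D M
  proof -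
    obtain as where as: "arc_listing D M as" using ex_arc_listing[OF G D] by blast
    note P = listing_perm_permutes[OF G D M _ as]
    have inV: "u \<in> V \<and> v \<in> V" if "(u, v) \<in> set as" for u v
    proof -
      have "{u, v} \<in> E" using that as D by (auto simp: arc_listing_def orientation_def)
      then show ?thesis using G by (auto simp: simple_graph_def)
    qed
    have "listing_perm \<nu>' as = \<sigma> \<circ> listing_perm \<nu> as"
    proof
      fix i
      show "listing_perm \<nu>' as i = (\<sigma> \<circ> listing_perm \<nu> as) i"
      proof (cases "i \<in> {1..2 * length as}")
        case True
        then have "as ! ((i - 1) div 2) \<in> set as" by auto
        then have "fst (as ! ((i - 1) div 2)) \<in> V" "snd (as ! ((i - 1) div 2)) \<in> V"
          using inV[of "fst (as ! ((i - 1) div 2))" "snd (as ! ((i - 1) div 2))"] by auto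
        then show ?thesis using True by (simp add: listing_perm_def \<sigma>_\<nu>)
      next
        case False
        then show ?thesis
          using P(2)[OF \<nu>] unfolding listing_perm_def \<sigma>_def by (simp only: o_def if_False)
      qed
    qed
    moreover have "permutation \<sigma>" "permutation (listing_perm \<nu> as)"
      using \<sigma> P(1)[OF \<nu>] permutation_permutes by blast+
    ultimately show ?thesis
      using matching_sign_eq[OF G D M \<nu> as] matching_sign_eq[OF G D M \<nu>' as]
      by (simp add: sign_compose)
  qed
  moreover have "sign \<sigma> \<in> {1, - 1}" by (cases \<sigma> rule: sign_cases) auto
  ultimately show ?thesis using that by blast
qed

lemma pfaffian_orientation_change_enumeration:
  assumes G: "simple_graph V E" and \<nu>: "enumeration V \<nu>" and \<nu>': "enumeration V \<nu>'"
    and Ds: "k_orientation E k Ds" and pf: "pfaffian_orientation V E \<nu> Ds"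
  shows "pfaffian_orientation V E \<nu>' Ds"
proof -
  obtain c where c: "c \<in> {1, - 1}"
    and eq: "\<And>D M. orientation E D \<Longrightarrow> M \<in> perfect_matchings V E \<Longrightarrow>
      matching_sign \<nu>' D M = c * matching_sign \<nu> D M"
    using matching_sign_change_enumeration[OF G \<nu> \<nu>'] by blast
  obtain x where x: "x \<in> carrier_vec (length Ds)"
    and sol: "\<And>M. M \<in> perfect_matchings V E \<Longrightarrow> sign_vector \<nu> Ds M \<bullet> x = 1"
    using pf by (auto simp: pfaffian_orientation_def)
  let ?c = "real_of_int c"
  have "sign_vector \<nu>' Ds M \<bullet> (?c \<cdot>\<^sub>v x) = 1" if M: "M \<in> perfect_matchings V E" for M
  proof -
    have "sign_vector \<nu>' Ds M = ?c \<cdot>\<^sub>v sign_vector \<nu> Ds M"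
      using Ds M eq by (intro eq_vecI) (auto simp: sign_vector_def k_orientation_def)
    moreover have "sign_vector \<nu> Ds M \<in> carrier_vec (length Ds)"
      by (simp add: sign_vector_def)
    ultimately have "sign_vector \<nu>' Ds M \<bullet> (?c \<cdot>\<^sub>v x) = ?c * (?c * (sign_vector \<nu> Ds M \<bullet> x))"
      using x by simp
    then show ?thesis using c sol[OF M] by auto
  qed
  then show ?thesis
    using x unfolding pfaffian_orientation_def by (intro bexI[of _ "?c \<cdot>\<^sub>v x"]) auto
qed

lemma k_pfaffian_iff:
  assumes "simple_graph V E" "enumeration V \<nu>"
  shows "k_pfaffian V E k \<longleftrightarrow>
    (\<exists>Ds. k_orientation E k Ds \<and> pfaffian_orientation V E \<nu> Ds)"
  unfolding k_pfaffian_def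
  using pfaffian_orientation_change_enumeration[OF assms(1) _ assms(2)] assms(2) by blast

lemma d_symbolic_pfaffian_iff:
  assumes G: "simple_graph V E" and \<nu>: "enumeration V \<nu>"
  shows "d_symbolic_pfaffian V E d \<longleftrightarrow>
    (\<exists>D \<tau>. symbolic_orientation E d D \<tau> \<and> pfaffian_symbolic V E \<nu> d D \<tau>)"
proof -
  have "pfaffian_symbolic V E \<nu> d D \<tau>"
    if \<nu>': "enumeration V \<nu>'" and D: "symbolic_orientation E d D \<tau>"
      and P: "pfaffian_symbolic V E \<nu>' d D \<tau>" for \<nu>' D \<tau>
  proof -
    obtain c where "\<And>D M. orientation E D \<Longrightarrow> M \<in> perfect_matchings V E \<Longrightarrow>
        matching_sign \<nu> D M = c * matching_sign \<nu>' D M"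
      using matching_sign_change_enumeration[OF G \<nu>' \<nu>] by blast
    then show ?thesis
      using D P unfolding pfaffian_symbolic_def symbolic_orientation_def by auto
  qed
  then show ?thesis unfolding d_symbolic_pfaffian_def using \<nu> by blast
qed

end

theory Submission
  imports Defs
begin

text \<open>
  Reversing the arcs of a set \<open>S\<close> of edges multiplies the sign of a perfect matching \<open>M\<close> by
  \<open>(- 1) ^ card (M \<inter> S)\<close>, because each reversed arc contributes one transposition
  (\<open>matching_sign_disagreement\<close>).  So for orientations \<open>D\<^sub>0, \<dots>, D\<^sub>d\<close> all the signs of \<open>M\<close> are
  determined by \<open>sign\<^bsub>D\<^sub>0\<^esub> M\<close> and the \<open>d\<close> parities of \<open>card (M \<inter> S\<^sub>i)\<close>, where \<open>S\<^sub>i\<close> is the set of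
  edges on which \<open>D\<^sub>0\<close> and \<open>D\<^sub>i\<close> disagree.  These parities are the symbolic sum \<open>\<tau> M\<close> when
  \<open>\<tau> e\<close> records which of the sets \<open>S\<^sub>1, \<dots>, S\<^sub>d\<close> contain \<open>e\<close>.  If two matchings have the same
  symbolic sum but opposite signs with respect to \<open>D\<^sub>0\<close>, then their sign vectors are opposite, and
  no \<open>x\<close> can have inner product \<open>1\<close> with both.  Hence a pfaffian \<open>(d + 1)\<close>-orientation gives a
  pfaffian \<open>d\<close>-symbolic orientation (\<open>k_pfaffian_imp_d_symbolic_pfaffian\<close>).

  It remains to see that the minimum defining the pfaffian number is attained
  (\<open>ex_k_pfaffian\<close>).  Let \<open>D\<^sub>S\<close> be a fixed orientation \<open>D\<close> with the edges in \<open>S\<close> reversed, and take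
  all the orientations \<open>D\<^sub>S\<close> with \<open>S \<subseteq> E\<close>.  The functions \<open>S \<mapsto> (- 1) ^ card (M \<inter> S)\<close> are distinct
  characters of the group of subsets of \<open>E\<close>, hence orthogonal, and so the Fourier transform of
  \<open>sign\<^bsub>D\<^esub>\<close> solves the linear system.
\<close>

section \<open>Reversing arcs and the sign of a matching\<close>

text \<open>The edges on which two orientations of the same graph differ.\<close>

definition disagreement :: "('a \<times> 'a) set \<Rightarrow> ('a \<times> 'a) set \<Rightarrow> 'a set set" where
  "disagreement D D' = {{u, v} | u v. (u, v) \<in> D \<and> (v, u) \<in> D'}"

text \<open>
  The permutation of the natural numbers that swaps \<open>2 * k + 1\<close> and \<open>2 * k + 2\<close> for all \<open>k \<in> K\<close>.
  These are the two positions belonging to entry \<open>k\<close> of a list of arcs: positions count from 1,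
  entries from 0.
\<close>

definition pair_swap :: "nat set \<Rightarrow> nat \<Rightarrow> nat" where
  "pair_swap K i =
     (if i = 0 \<or> (i - 1) div 2 \<notin> K then i else if odd i then i + 1 else i - 1)"

lemma pair_swap_empty: "pair_swap {} = id"
  by (rule ext) (simp add: pair_swap_def)

lemma pair_swap_insert:
  assumes "k \<notin> K"
  shows "pair_swap (insert k K) = transpose (2 * k + 1) (2 * k + 2) \<circ> pair_swap K"
proof
  fix i
  show "pair_swap (insert k K) i = (transpose (2 * k + 1) (2 * k + 2) \<circ> pair_swap K) i"
  proof (cases i)
    case 0
    then show ?thesis by (simp add: pair_swap_def transpose_def)
  next
    case (Suc j)
    define q where "q = j div 2"
    have j: "j = 2 * q \<or> j = 2 * q + 1" unfolding q_def by linarith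
    show ?thesis
    proof (cases "q = k")
      case True
      then show ?thesis using assms j by (auto simp: pair_swap_def Suc transpose_def)
    next
      case False
      have "pair_swap K i = 2 * q + 1 \<or> pair_swap K i = 2 * q + 2"
        using j by (auto simp: pair_swap_def Suc)
      then have "pair_swap K i \<noteq> 2 * k + 1" "pair_swap K i \<noteq> 2 * k + 2"
        using False by presburger+
      moreover have "pair_swap (insert k K) i = pair_swap K i"
        using False by (simp add: pair_swap_def Suc q_def)
      ultimately show ?thesis by (simp add: transpose_def)
    qed
  qed
qed

lemma pair_swap_sign:
  assumes "finite K"
  shows "permutation (pair_swap K) \<and> sign (pair_swap K) = (- 1) ^ card K"
  using assms
proof (induction K rule: finite_induct)
  case empty
  then show ?case by (simp add: pair_swap_empty)
next
  case (insert k K)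
  let ?t = "transpose (2 * k + 1) (2 * k + 2)"
  have t: "permutation ?t" "sign ?t = - 1"
    by (rule permutation_swap_id) (subst sign_swap_id, simp)
  have "permutation (?t \<circ> pair_swap K)" "sign (?t \<circ> pair_swap K) = - sign (pair_swap K)"
    using insert.IH t by (simp_all only: permutation_compose sign_compose mult_minus1)
  then show ?case
    using insert by (simp only: pair_swap_insert card_insert_disjoint power_Suc mult_minus1 simp_thms)
qed

lemma simple_graph_finite_edges:
  assumes "simple_graph V E"
  shows "finite E"
  using assms finite_subset[of E "Pow V"] by (auto simp: simple_graph_def)

lemma matching_sign_disagreement:
  assumes G: "simple_graph V E" and D: "orientation E D" and D': "orientation E D'"
    and M: "M \<in> perfect_matchings V E" and \<nu>: "enumeration V \<nu>"
  shows "matching_sign \<nu> D' M = (- 1) ^ card (M \<inter> disagreement D D') * matching_sign \<nu> D M"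
proof -
  obtain as where as: "arc_listing D M as" using ex_arc_listing[OF G D] by blast
  define turn where "turn p = (if p \<in> D' then p else (snd p, fst p))" for p :: "'a \<times> 'a"
  define bs where "bs = map turn as"
  define K where "K = {k. k < length as \<and> as ! k \<notin> D'}"
  have ME: "M \<subseteq> E" using M by (simp add: perfect_matchings_def)
  have arcs: "set as = {(u, v) \<in> D. {u, v} \<in> M}" and dist: "distinct as"
    using as by (auto simp: arc_listing_def)
  have flip: "(u, v) \<in> X \<longleftrightarrow> (v, u) \<notin> X" if "{u, v} \<in> M" "orientation E X" for u v X
    using that ME unfolding orientation_def by blast
  have as_eqI: "p = q" if pq: "p \<in> set as" "q \<in> set as" "{fst p, snd p} = {fst q, snd q}" for p q
  proof -
    have "q = p \<or> q = (snd p, fst p)"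
      using pq(3) by (metis doubleton_eq_iff prod.collapse)
    then show ?thesis using pq(1,2) arcs flip[OF _ D] by (cases p) auto
  qed
  have bs: "arc_listing D' M bs"
    unfolding arc_listing_def
  proof
    have "inj_on turn (set as)"
    proof (rule inj_onI)
      fix p q assume "p \<in> set as" "q \<in> set as" "turn p = turn q"
      then show "p = q"
        by (intro as_eqI) (auto simp: turn_def split: if_splits)
    qed
    then show "distinct bs" using dist by (simp add: bs_def distinct_map)
    show "set bs = {(u, v) \<in> D'. {u, v} \<in> M}"
    proof
      show "set bs \<subseteq> {(u, v) \<in> D'. {u, v} \<in> M}"
      proof
        fix p assume "p \<in> set bs"
        then obtain u v where uv: "(u, v) \<in> set as" "p = turn (u, v)" by (auto simp: bs_def)
        then have "{u, v} \<in> M" "{v, u} \<in> M" using arcs by (auto simp: insert_commute)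
        then show "p \<in> {(u, v) \<in> D'. {u, v} \<in> M}"
          using uv(2) flip[OF _ D', of u v] by (simp add: turn_def)
      qed
    next
      show "{(u, v) \<in> D'. {u, v} \<in> M} \<subseteq> set bs"
      proof clarify
        fix u v assume uv: "(u, v) \<in> D'" "{u, v} \<in> M"
        have vu: "{v, u} \<in> M" using uv(2) by (simp add: insert_commute)
        show "(u, v) \<in> set bs"
        proof (cases "(u, v) \<in> D")
          case True
          then have "(u, v) \<in> set as" using uv arcs by auto
          moreover have "turn (u, v) = (u, v)" using uv by (simp add: turn_def)
          ultimately show ?thesis unfolding bs_def by (metis image_eqI set_map)
        next
          case False
          then have "(v, u) \<in> set as" using vu flip[OF uv(2) D] arcs by auto
          moreover have "turn (v, u) = (u, v)"
            using uv flip[OF vu D'] by (simp add: turn_def)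
          ultimately show ?thesis unfolding bs_def by (metis image_eqI set_map)
        qed
      qed
    qed
  qed
  have len: "length bs = length as" by (simp add: bs_def)
  have perm: "listing_perm \<nu> bs = listing_perm \<nu> as \<circ> pair_swap K"
  proof
    fix i
    show "listing_perm \<nu> bs i = (listing_perm \<nu> as \<circ> pair_swap K) i"
    proof (cases "i \<in> {1..2 * length as}")
      case True
      define k where "k = (i - 1) div 2"
      have k: "k < length as" using True by (auto simp: k_def)
      have le: "Suc (Suc (2 * k)) \<le> 2 * length as" using k by simp
      have i: "i = 2 * k + 1 \<or> i = 2 * k + 2" using True unfolding k_def by auto
      show ?thesis
        using i k le by (auto simp: listing_perm_def pair_swap_def K_def bs_def turn_def)
    next
      case False
      then have "pair_swap K i = i" by (auto simp: pair_swap_def K_def)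
      then show ?thesis using False by (auto simp: listing_perm_def len)
    qed
  qed
  have "bij_betw (\<lambda>k. {fst (as ! k), snd (as ! k)}) K (M \<inter> disagreement D D')"
    unfolding bij_betw_def
  proof
    show "inj_on (\<lambda>k. {fst (as ! k), snd (as ! k)}) K"
    proof (rule inj_onI)
      fix k l assume kl: "k \<in> K" "l \<in> K"
        "{fst (as ! k), snd (as ! k)} = {fst (as ! l), snd (as ! l)}"
      then have "as ! k = as ! l" by (intro as_eqI) (auto simp: K_def)
      then show "k = l" using kl dist by (simp add: K_def nth_eq_iff_index_eq)
    qed
    show "(\<lambda>k. {fst (as ! k), snd (as ! k)}) ` K = M \<inter> disagreement D D'"
    proof
      show "(\<lambda>k. {fst (as ! k), snd (as ! k)}) ` K \<subseteq> M \<inter> disagreement D D'"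
      proof
        fix e assume "e \<in> (\<lambda>k. {fst (as ! k), snd (as ! k)}) ` K"
        then obtain k where k: "k < length as" "as ! k \<notin> D'" "e = {fst (as ! k), snd (as ! k)}"
          by (auto simp: K_def)
        obtain u v where uv: "as ! k = (u, v)" by fastforce
        have "(u, v) \<in> D" "{u, v} \<in> M" using arcs k(1) uv nth_mem by fastforce+
        moreover from this have "(v, u) \<in> D'" using flip[OF _ D'] k uv by auto
        ultimately show "e \<in> M \<inter> disagreement D D'"
          using k uv by (auto simp: disagreement_def)
      qed
      show "M \<inter> disagreement D D' \<subseteq> (\<lambda>k. {fst (as ! k), snd (as ! k)}) ` K"
      proof
        fix e assume "e \<in> M \<inter> disagreement D D'"
        then obtain u v where uv: "e = {u, v}" "{u, v} \<in> M" "(u, v) \<in> D" "(v, u) \<in> D'"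
          by (auto simp: disagreement_def)
        then have "(u, v) \<in> set as" using arcs by auto
        then obtain k where "k < length as" "as ! k = (u, v)" by (auto simp: in_set_conv_nth)
        moreover have "(u, v) \<notin> D'" using flip[OF uv(2) D'] uv by simp
        ultimately show "e \<in> (\<lambda>k. {fst (as ! k), snd (as ! k)}) ` K"
          using uv by (intro image_eqI[of _ _ k]) (auto simp: K_def)
      qed
    qed
  qed
  then have "card K = card (M \<inter> disagreement D D')" by (rule bij_betw_same_card)
  moreover have "finite K" by (simp add: K_def)
  moreover have "permutation (listing_perm \<nu> as)"
    using listing_perm_permutes(1)[OF G D M \<nu> as] permutation_permutes by blast
  ultimately show ?thesis
    using pair_swap_sign[of K]
    by (simp add: matching_sign_eq[OF G D M \<nu> as] matching_sign_eq[OF G D' M \<nu> bs] perm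
        sign_compose mult.commute)
qed

section \<open>From pfaffian orientations to symbolic pfaffian orientations\<close>

lemma symbolic_sum_indicators:
  assumes "finite M" "i < d"
  shows "symbolic_sum d (\<lambda>e. vec d (\<lambda>j. of_bool (e \<in> S j))) M $ i = of_nat (card (M \<inter> S i))"
  using assms
  by (simp add: symbolic_sum_def index_finsum_vec of_bool_def sum.If_cases)

lemma of_nat_bit_eq_imp_power_eq:
  assumes "(of_nat m :: bit) = of_nat n"
  shows "(- 1 :: int) ^ m = (- 1) ^ n"
proof -
  have "(of_nat n :: bit) = of_bool (odd n)" for n
    by (induction n) simp_all
  then have "even m \<longleftrightarrow> even n" using assms by (auto simp: of_bool_def split: if_splits)
  then show ?thesis by (simp add: minus_one_power_iff)
qed

lemma k_pfaffian_imp_d_symbolic_pfaffian: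
  assumes G: "simple_graph V E" and k: "k_pfaffian V E (Suc d)"
  shows "d_symbolic_pfaffian V E d"
proof -
  obtain \<nu> Ds x where \<nu>: "enumeration V \<nu>" and len: "length Ds = Suc d"
    and ori: "\<And>D. D \<in> set Ds \<Longrightarrow> orientation E D"
    and x: "x \<in> carrier_vec (Suc d)"
    and sol: "\<And>M. M \<in> perfect_matchings V E \<Longrightarrow> sign_vector \<nu> Ds M \<bullet> x = 1"
    using k by (auto simp: k_pfaffian_def k_orientation_def pfaffian_orientation_def)
  have D: "orientation E (Ds ! i)" if "i < Suc d" for i
    using that ori len by simp
  define S where "S i = disagreement (Ds ! 0) (Ds ! Suc i)" for i
  define \<tau> where "\<tau> e = vec d (\<lambda>i. of_bool (e \<in> S i) :: bit)" for e
  have "symbolic_sum d \<tau> M \<noteq> symbolic_sum d \<tau> N"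
    if M: "M \<in> perfect_matchings V E" and N: "N \<in> perfect_matchings V E"
      and ne: "matching_sign \<nu> (Ds ! 0) M \<noteq> matching_sign \<nu> (Ds ! 0) N" for M N
  proof
    assume eq: "symbolic_sum d \<tau> M = symbolic_sum d \<tau> N"
    have fin: "finite M" "finite N"
      using M N simple_graph_finite_edges[OF G] finite_subset
      by (auto simp: perfect_matchings_def)
    have opp0: "matching_sign \<nu> (Ds ! 0) M = - matching_sign \<nu> (Ds ! 0) N"
      using ne unfolding matching_sign_def by (auto simp: sign_def split: if_splits)
    have opp: "matching_sign \<nu> (Ds ! i) M = - matching_sign \<nu> (Ds ! i) N" if i: "i < Suc d" for i
    proof (cases i)
      case 0
      then show ?thesis using opp0 by simp
    next
      case (Suc j)
      then have j: "j < d" using i by simp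
      have "(of_nat (card (M \<inter> S j)) :: bit) = of_nat (card (N \<inter> S j))"
        using eq symbolic_sum_indicators[OF fin(1) j, of S] symbolic_sum_indicators[OF fin(2) j, of S]
        unfolding \<tau>_def by simp
      then have "(- 1 :: int) ^ card (M \<inter> S j) = (- 1) ^ card (N \<inter> S j)"
        by (rule of_nat_bit_eq_imp_power_eq)
      then show ?thesis
        using opp0 matching_sign_disagreement[OF G D[of 0] D[OF i] M \<nu>]
          matching_sign_disagreement[OF G D[of 0] D[OF i] N \<nu>]
        by (simp add: Suc S_def)
    qed
    have "sign_vector \<nu> Ds M = - sign_vector \<nu> Ds N"
      using opp by (intro eq_vecI) (auto simp: sign_vector_def len)
    moreover have "sign_vector \<nu> Ds N \<in> carrier_vec (Suc d)" by (simp add: sign_vector_def len)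
    ultimately have "sign_vector \<nu> Ds M \<bullet> x = - (sign_vector \<nu> Ds N \<bullet> x)"
      using x by simp
    then show False using sol[OF M] sol[OF N] by simp
  qed
  moreover have "symbolic_orientation E d (Ds ! 0) \<tau>"
    using D[of 0] by (auto simp: symbolic_orientation_def symbolic_function_def \<tau>_def)
  ultimately show ?thesis
    using \<nu> unfolding d_symbolic_pfaffian_def pfaffian_symbolic_def by blast
qed

section \<open>Existence of a pfaffian orientation\<close>

lemma ex_orientation:
  assumes "simple_graph V E"
  shows "\<exists>D. orientation E D"
proof -
  obtain \<nu> where "enumeration V \<nu>" using ex_enumeration[of V] assms by (auto simp: simple_graph_def)
  then have inj: "inj_on \<nu> V" by (auto simp: enumeration_def bij_betw_def)
  have ne: "\<nu> u \<noteq> \<nu> v" if "{u, v} \<in> E" for u v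
  proof -
    have "{u, v} \<subseteq> V" "card {u, v} = 2" using that assms by (auto simp: simple_graph_def)
    moreover from this have "u \<noteq> v" by auto
    ultimately show ?thesis using inj_onD[OF inj, of u v] by blast
  qed
  have "\<nu> u < \<nu> v \<longleftrightarrow> \<not> ({v, u} \<in> E \<and> \<nu> v < \<nu> u)" if "{u, v} \<in> E" for u v
    using ne[OF that] that by (simp add: insert_commute) linarith
  then have "orientation E {(u, v). {u, v} \<in> E \<and> \<nu> u < \<nu> v}"
    unfolding orientation_def by simp
  then show ?thesis by blast
qed

text \<open>The orientation obtained from \<open>D\<close> by reversing the edges in \<open>S\<close>.\<close>

definition reorient :: "('a \<times> 'a) set \<Rightarrow> 'a set set \<Rightarrow> ('a \<times> 'a) set" where
  "reorient D S = {(u, v). if {u, v} \<in> S then (v, u) \<in> D else (u, v) \<in> D}"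

lemma orientation_reorient:
  assumes "orientation E D"
  shows "orientation E (reorient D S)"
  unfolding orientation_def
proof (intro conjI allI impI)
  fix u v :: 'a
  have comm: "{v, u} = {u, v}" by (rule insert_commute)
  show "{u, v} \<in> E" if "(u, v) \<in> reorient D S"
  proof -
    have "(u, v) \<in> D \<or> (v, u) \<in> D" using that by (auto simp: reorient_def split: if_splits)
    then have "{u, v} \<in> E \<or> {v, u} \<in> E" using assms unfolding orientation_def by blast
    then show ?thesis by (simp add: comm)
  qed
  show "(u, v) \<in> reorient D S \<longleftrightarrow> (v, u) \<notin> reorient D S" if "{u, v} \<in> E"
  proof -
    have "(u, v) \<in> D \<longleftrightarrow> (v, u) \<notin> D" using that assms unfolding orientation_def by blast
    then show ?thesis by (simp add: reorient_def comm)
  qed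
qed

lemma disagreement_reorient:
  assumes G: "simple_graph V E" and D: "orientation E D" and S: "S \<subseteq> E"
  shows "disagreement D (reorient D S) = S"
proof
  show "disagreement D (reorient D S) \<subseteq> S"
  proof
    fix e assume "e \<in> disagreement D (reorient D S)"
    then obtain u v where uv: "e = {u, v}" "(u, v) \<in> D" "(v, u) \<in> reorient D S"
      by (auto simp: disagreement_def)
    moreover have "(v, u) \<notin> D" using uv D unfolding orientation_def by blast
    ultimately show "e \<in> S"
      by (auto simp: reorient_def insert_commute split: if_splits)
  qed
  show "S \<subseteq> disagreement D (reorient D S)"
  proof
    fix e assume e: "e \<in> S"
    then have "card e = 2" using S G by (auto simp: simple_graph_def)
    then obtain a b where "e = {a, b}" by (auto simp: card_2_iff)
    moreover from this have "(a, b) \<in> D \<or> (b, a) \<in> D"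
      using D e S unfolding orientation_def by blast
    ultimately obtain u v where uv: "e = {u, v}" "(u, v) \<in> D"
      by (auto simp: insert_commute)
    then have "(v, u) \<in> reorient D S" using e by (simp add: reorient_def insert_commute)
    then show "e \<in> disagreement D (reorient D S)" using uv by (auto simp: disagreement_def)
  qed
qed

text \<open>Orthogonality of the characters of the group of subsets of \<open>E\<close>.\<close>

lemma sum_Pow_parity:
  assumes E: "finite E" and M: "M \<subseteq> E" and N: "N \<subseteq> E"
  shows "(\<Sum>S\<in>Pow E. (- 1) ^ card (M \<inter> S) * (- 1) ^ card (N \<inter> S)) =
    (if M = N then 2 ^ card E else (0 :: real))"
proof (cases "M = N")
  case True
  then show ?thesis using E by (simp add: card_Pow flip: power_mult_distrib)
next
  case False
  define \<chi> where "\<chi> S = (- 1 :: real) ^ card (M \<inter> S) * (- 1) ^ card (N \<inter> S)" for S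
  obtain a where a: "a \<in> E" "a \<in> M \<longleftrightarrow> a \<notin> N" using False M N by blast
  define E' where "E' = E - {a}"
  have E': "finite E'" "a \<notin> E'" "E = insert a E'" using E a by (auto simp: E'_def)
  have neg: "\<chi> (insert a S) = - \<chi> S" if S: "S \<in> Pow E'" for S
  proof -
    have "finite S" "a \<notin> S" using S E' finite_subset by auto
    then show ?thesis using a(2) by (cases "a \<in> M") (simp_all add: \<chi>_def)
  qed
  have inj: "inj_on (insert a) (Pow E')"
    using E'(2) by (intro inj_onI) (metis PowD insert_ident subsetD)
  have "sum \<chi> (Pow E) = sum \<chi> (Pow E') + sum \<chi> (insert a ` Pow E')"
    unfolding E'(3) Pow_insert using E' by (intro sum.union_disjoint) auto
  also have "\<dots> = 0"
    using neg by (simp add: sum.reindex[OF inj] sum_negf)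
  finally show ?thesis using False by (simp add: \<chi>_def)
qed

lemma ex_k_pfaffian:
  assumes G: "simple_graph V E"
  shows "\<exists>k>0. k_pfaffian V E k"
proof -
  have E: "finite E" by (rule simple_graph_finite_edges[OF G])
  obtain \<nu> where \<nu>: "enumeration V \<nu>" using ex_enumeration[of V] G by (auto simp: simple_graph_def)
  obtain D where D: "orientation E D" using ex_orientation[OF G] by blast
  obtain Ss where Ss: "set Ss = Pow E" "distinct Ss"
    using finite_distinct_list E by (metis finite_Pow_iff)
  define Ds where "Ds = map (reorient D) Ss"
  let ?PM = "perfect_matchings V E"
  have PM: "M \<subseteq> E" if "M \<in> ?PM" for M using that by (simp add: perfect_matchings_def)
  have fin: "finite ?PM" using PM E by (intro finite_subset[of ?PM "Pow E"]) auto
  define s where "s M = real_of_int (matching_sign \<nu> D M)" for M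
  define \<chi> where "\<chi> M S = (- 1 :: real) ^ card (M \<inter> S)" for M S :: "'a set set"
  have s2: "s M * s M = 1" for M
    by (simp add: s_def matching_sign_def sign_def)
  have sgn: "real_of_int (matching_sign \<nu> (reorient D S) M) = \<chi> M S * s M"
    if "S \<in> Pow E" "M \<in> ?PM" for S M
    using that matching_sign_disagreement[OF G D orientation_reorient[OF D] that(2) \<nu>, of S]
      disagreement_reorient[OF G D, of S]
    by (simp add: \<chi>_def s_def)
  \<comment> \<open>The Fourier transform of \<open>s\<close>, extended by \<open>0\<close> from the perfect matchings to all subsets of \<open>E\<close>.\<close>
  define c where "c S = (\<Sum>N\<in>?PM. s N * \<chi> N S) / 2 ^ card E" for S
  define x where "x = vec (length Ss) (\<lambda>i. c (Ss ! i))"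
  have "sign_vector \<nu> Ds M \<bullet> x = 1" if M: "M \<in> ?PM" for M
  proof -
    have "sign_vector \<nu> Ds M \<bullet> x =
        (\<Sum>i<length Ss. real_of_int (matching_sign \<nu> (reorient D (Ss ! i)) M) * c (Ss ! i))"
      by (simp add: scalar_prod_def sign_vector_def x_def Ds_def atLeast0LessThan)
    also have "\<dots> = (\<Sum>S\<in>Pow E. real_of_int (matching_sign \<nu> (reorient D S) M) * c S)"
      by (rule sum.reindex_bij_betw[OF bij_betw_nth]) (use Ss in auto)
    also have "\<dots> = (\<Sum>S\<in>Pow E. \<Sum>N\<in>?PM. s M * s N / 2 ^ card E * (\<chi> M S * \<chi> N S))"
      by (intro sum.cong refl)
         (simp add: sgn[OF _ M] c_def sum_divide_distrib sum_distrib_left mult_ac)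
    also have "\<dots> = (\<Sum>N\<in>?PM. s M * s N / 2 ^ card E * (\<Sum>S\<in>Pow E. \<chi> M S * \<chi> N S))"
      by (subst sum.swap) (simp add: sum_distrib_left)
    also have "\<dots> = (\<Sum>N\<in>?PM. if M = N then s M * s N else 0)"
      using PM M by (intro sum.cong) (simp_all add: \<chi>_def sum_Pow_parity[OF E])
    also have "\<dots> = 1" using M fin s2 by simp
    finally show ?thesis .
  qed
  moreover have "x \<in> carrier_vec (length Ds)" by (simp add: x_def Ds_def)
  moreover have "k_orientation E (length Ss) Ds"
    using orientation_reorient[OF D] by (auto simp: k_orientation_def Ds_def)
  ultimately have "k_pfaffian V E (length Ss)"
    using \<nu> unfolding k_pfaffian_def pfaffian_orientation_def by blast
  moreover have "length Ss > 0" using Ss by auto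
  ultimately show ?thesis by blast
qed

section \<open>Comparison of the two numbers\<close>

theorem theorem13:
  fixes V :: "'a set" and E :: "'a set set"
  assumes "simple_graph V E"
  shows "pf V E \<ge> spf V E + 1"
proof -
  have "0 < pf V E \<and> k_pfaffian V E (pf V E)"
    unfolding pf_def by (rule LeastI_ex[OF ex_k_pfaffian[OF assms]])
  then obtain d where d: "pf V E = Suc d" "k_pfaffian V E (Suc d)"
    by (cases "pf V E") auto
  have "spf V E \<le> d"
    unfolding spf_def by (rule Least_le, rule k_pfaffian_imp_d_symbolic_pfaffian[OF assms d(2)])
  then show ?thesis using d by simp
qed

end
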